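(* For all constants $\alpha\ge1$ and $\beta\ge1$, there is a restricted-assignment instance with a nonempty bounded uncertainty set $\mathcal U$ (and a predicted scenario $\hat q\in\mathcal U$) such that no randomized algorithm is both $\alpha$-consistent and $\beta$-robust on it; that is, there is no random schedule $\mathcal S$ with $$\mathbb E[C_{\max}(\mathcal S,\hat q)]\le\alpha\,\mathrm{OPT}(\hat q)\quad\text{and}\quad \mathbb E[C_{\max}(\mathcal S,q)]\le\beta\,\mathrm{OPT}^{\mathrm{rob}}(\mathcal U)\ \text{ for all } q\in\mathcal U.$$
   Context: There are $m$ machines and $n$ jobs. Restricted assignment: each job $j$ has a nonempty eligibility set $M_j\subseteq[m]$, fixed across scenarios; a scenario $q$ is given by a vector of job sizes $p(q)\in\mathbb R_{\ge0}^n$, with processing times $q_{i,j}=p(q)_j$ if $i\in M_j$ and $q_{i,j}=\infty$ otherwise. An uncertainty set $\mathcal U$ is an arbitrary set of such scenarios; nonempty and bounded refers to the set of size vectors in $\mathbb R_{\ge0}^n$. A schedule is a partition $\mathcal S=(S_1,\dots,S_m)$ of $[n]$ (parts may be empty), and $C_{\max}(\mathcal S,q)=\max_{i}\sum_{j\in S_i}q_{i,j}$. $\mathrm{OPT}(q)=\min_{\mathcal S}C_{\max}(\mathcal S,q)$ and $\mathrm{OPT}^{\mathrm{rob}}(\mathcal U)=\min_{\mathcal S}\sup_{q\in\mathcal U}C_{\max}(\mathcal S,q)$, minima over deterministic schedules. A randomized algorithm returns, on input $(\mathcal U,\hat q)$, a random schedule; its consistency and robustness are measured in expectation, with the scenario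 $q$ chosen independently of the algorithm's randomness. *)

theory Defs
  imports "HOL-Probability.Probability"
begin

text \<open>
  Machines are \<open>{..<m}\<close> and jobs are \<open>{..<n}\<close>. A scenario is a matrix of processing times
  \<open>q :: nat \<Rightarrow> nat \<Rightarrow> ennreal\<close> with machine index first; only its entries \<open>q i j\<close> with
  \<open>i < m\<close> and \<open>j < n\<close> matter.
\<close>

text \<open>The parts of a schedule may be empty. Extensionality makes the set of schedules finite.\<close>

definition schedules :: "nat \<Rightarrow> nat \<Rightarrow> (nat \<Rightarrow> nat set) set" where
  "schedules m n =
     {S \<in> {..<m} \<rightarrow>\<^sub>E Pow {..<n}. disjoint_family_on S {..<m} \<and> (\<Union>i<m. S i) = {..<n}}"

definition Cmax :: "nat \<Rightarrow> (nat \<Rightarrow> nat set) \<Rightarrow> (nat \<Rightarrow> nat \<Rightarrow> ennreal) \<Rightarrow> ennreal" where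
  "Cmax m S q = (MAX i\<in>{..<m}. \<Sum>j\<in>S i. q i j)"

definition OPT :: "nat \<Rightarrow> nat \<Rightarrow> (nat \<Rightarrow> nat \<Rightarrow> ennreal) \<Rightarrow> ennreal" where
  "OPT m n q = (MIN S\<in>schedules m n. Cmax m S q)"

definition OPT_rob :: "nat \<Rightarrow> nat \<Rightarrow> (nat \<Rightarrow> nat \<Rightarrow> ennreal) set \<Rightarrow> ennreal" where
  "OPT_rob m n U = (MIN S\<in>schedules m n. SUP q\<in>U. Cmax m S q)"

definition eligibility :: "nat \<Rightarrow> nat \<Rightarrow> (nat \<Rightarrow> nat set) \<Rightarrow> bool" where
  "eligibility m n M \<longleftrightarrow> (\<forall>j<n. M j \<noteq> {} \<and> M j \<subseteq> {..<m})"

definition size_vectors :: "nat \<Rightarrow> (nat \<Rightarrow> real) set" where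
  "size_vectors n = {..<n} \<rightarrow>\<^sub>E {0..}"

text \<open>
  Boundedness in \<open>n\<close>-dimensional real space, written out coordinatewise: the library's
  \<open>bounded\<close> on \<open>nat \<Rightarrow> real\<close> refers to a bounded product metric and is not the intended notion.
\<close>

definition bounded_sizes :: "nat \<Rightarrow> (nat \<Rightarrow> real) set \<Rightarrow> bool" where
  "bounded_sizes n P \<longleftrightarrow> (\<exists>B. \<forall>p\<in>P. \<forall>j<n. \<bar>p j\<bar> \<le> B)"

definition restricted_scenario ::
    "(nat \<Rightarrow> nat set) \<Rightarrow> (nat \<Rightarrow> real) \<Rightarrow> nat \<Rightarrow> nat \<Rightarrow> ennreal" where
  "restricted_scenario M p = (\<lambda>i j. if i \<in> M j then ennreal (p j) else \<infinity>)"

text \<open>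
  There are only finitely many schedules, so the law of a random schedule is a probability mass
  function. Expectations are nonnegative integrals because \<open>Cmax\<close> may be infinite.
\<close>

definition random_schedule :: "nat \<Rightarrow> nat \<Rightarrow> (nat \<Rightarrow> nat set) pmf \<Rightarrow> bool" where
  "random_schedule m n D \<longleftrightarrow> set_pmf D \<subseteq> schedules m n"

definition expected_Cmax ::
    "nat \<Rightarrow> (nat \<Rightarrow> nat set) pmf \<Rightarrow> (nat \<Rightarrow> nat \<Rightarrow> ennreal) \<Rightarrow> ennreal" where
  "expected_Cmax m D q = (\<integral>\<^sup>+ S. Cmax m S q \<partial>measure_pmf D)"

definition consistent ::
    "nat \<Rightarrow> nat \<Rightarrow> (nat \<Rightarrow> nat \<Rightarrow> ennreal) \<Rightarrow> real \<Rightarrow> (nat \<Rightarrow> nat set) pmf \<Rightarrow> bool" where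
  "consistent m n q \<alpha> D \<longleftrightarrow> expected_Cmax m D q \<le> ennreal \<alpha> * OPT m n q"

definition robust ::
    "nat \<Rightarrow> nat \<Rightarrow> (nat \<Rightarrow> nat \<Rightarrow> ennreal) set \<Rightarrow> real \<Rightarrow> (nat \<Rightarrow> nat set) pmf \<Rightarrow> bool" where
  "robust m n U \<beta> D \<longleftrightarrow> (\<forall>q\<in>U. expected_Cmax m D q \<le> ennreal \<beta> * OPT_rob m n U)"

end

theory Submission
  imports Defs
begin

text \<open>
  There are \<open>N\<close> home machines, \<open>T\<close> shared machines and one job for each pair \<open>(g, t)\<close>, eligible
  exactly on home machine \<open>g\<close> and shared machine \<open>t\<close>. In the predicted scenario all sizes are 1, so
  using only shared machines gives \<open>OPT \<le> N\<close>. In scenario \<open>t\<close> the jobs of shared machine \<open>t\<close> have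
  size \<open>T\<close> and all others have size 0, so using only home machines gives \<open>OPT_rob \<le> T\<close>.
  In expectation, a consistent schedule has at most \<open>\<alpha> N\<close> jobs on each home machine, and a robust one
  at most \<open>\<beta>\<close> jobs on each shared machine; together this accounts for at most \<open>\<alpha> N\<^sup>2 + \<beta> T\<close> of the \<open>N T\<close> jobs,
  which is too few once \<open>N > 2 \<beta>\<close> and \<open>T \<ge> 2 \<alpha> N\<close>. The count is linear in the expected makespans,
  so randomization does not help.
\<close>

section \<open>Makespans and optima for general schedules\<close>

lemma finite_schedules: "finite (schedules m n)"
  unfolding schedules_def by (rule finite_subset[of _ "{..<m} \<rightarrow>\<^sub>E Pow {..<n}"]) (auto intro: finite_PiE)

lemma Cmax_le:
  assumes "0 < m" and "\<And>i. i < m \<Longrightarrow> (\<Sum>j\<in>S i. q i j) \<le> c"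
  shows "Cmax m S q \<le> c"
  unfolding Cmax_def using assms by (subst Max_le_iff) auto

lemma load_le_Cmax:
  assumes "i < m"
  shows "(\<Sum>j\<in>S i. q i j) \<le> Cmax m S q"
  unfolding Cmax_def using assms by (intro Max_ge) auto

lemma OPT_le:
  assumes "S \<in> schedules m n"
  shows "OPT m n q \<le> Cmax m S q"
  unfolding OPT_def using assms by (intro Min_le) (auto simp: finite_schedules)

lemma OPT_rob_le:
  assumes "S \<in> schedules m n" and "\<And>q. q \<in> U \<Longrightarrow> Cmax m S q \<le> c"
  shows "OPT_rob m n U \<le> c"
proof -
  have "OPT_rob m n U \<le> (SUP q\<in>U. Cmax m S q)"
    unfolding OPT_rob_def using assms(1) by (intro Min_le) (auto simp: finite_schedules)
  also have "\<dots> \<le> c"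
    using assms(2) by (rule SUP_least)
  finally show ?thesis .
qed

text \<open>\<open>schedules\<close> contains only extensional functions, hence the restriction to
  \<open>{..<m}\<close>.\<close>

definition schedule_of :: "nat \<Rightarrow> nat \<Rightarrow> (nat \<Rightarrow> nat) \<Rightarrow> nat \<Rightarrow> nat set" where
  "schedule_of m n f = (\<lambda>i\<in>{..<m}. {j. j < n \<and> f j = i})"

lemma schedule_of_in_schedules:
  assumes "\<And>j. j < n \<Longrightarrow> f j < m"
  shows "schedule_of m n f \<in> schedules m n"
  using assms unfolding schedule_of_def schedules_def disjoint_family_on_def by auto

lemma Cmax_schedule_of_le:
  assumes "0 < m"
    and "\<And>i. i < m \<Longrightarrow> (\<Sum>j | j < n \<and> f j = i. q i j) \<le> c"
  shows "Cmax m (schedule_of m n f) q \<le> c"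
  using assms by (intro Cmax_le) (auto simp: schedule_of_def)

text \<open>Serves to separate home machines from shared ones in a sum over all machines.\<close>

lemma sum_lessThan_add:
  fixes f :: "nat \<Rightarrow> 'a::comm_monoid_add"
  shows "(\<Sum>i<a + b. f i) = (\<Sum>i<a. f i) + (\<Sum>i<b. f (a + i))"
  by (induction b) (simp_all add: add.assoc)

lemma sum_card_schedule:
  assumes "S \<in> schedules m n"
  shows "(\<Sum>i<m. card (S i)) = n"
proof -
  have "card (\<Union>i<m. S i) = (\<Sum>i<m. card (S i))"
    using assms unfolding schedules_def
    by (intro card_UN_disjoint)
      (auto simp: disjoint_family_on_def PiE_def Pi_def intro: finite_subset[of _ "{..<n}"])
  with assms show ?thesis by (simp add: schedules_def)
qed

lemma card_times_le_sum_ennreal: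
  fixes f :: "'a \<Rightarrow> ennreal"
  assumes "\<And>j. j \<in> A \<Longrightarrow> c \<le> f j"
  shows "of_nat (card A) * c \<le> (\<Sum>j\<in>A. f j)"
  using sum_mono[of A "\<lambda>_. c" f] assms by simp

section \<open>The instance and its uncertainty set\<close>

context
  fixes N T :: nat
begin

text \<open>The job \<open>(g, t)\<close> has number \<open>g + N * t\<close>; the shared machine \<open>t\<close> has number \<open>N + t\<close>.\<close>

definition elig :: "nat \<Rightarrow> nat set" where
  "elig j = {j mod N, N + j div N}"

definition pred_sizes :: "nat \<Rightarrow> real" where
  "pred_sizes = (\<lambda>j\<in>{..<N * T}. 1)"

definition peak_sizes :: "nat \<Rightarrow> nat \<Rightarrow> real" where
  "peak_sizes t = (\<lambda>j\<in>{..<N * T}. if j div N = t then real T else 0)"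

definition size_set :: "(nat \<Rightarrow> real) set" where
  "size_set = insert pred_sizes (peak_sizes ` {..<T})"

abbreviation "q_pred \<equiv> restricted_scenario elig pred_sizes"
abbreviation "q_peak t \<equiv> restricted_scenario elig (peak_sizes t)"

lemma div_less_T: "j < N * T \<Longrightarrow> j div N < T"
  by (simp add: less_mult_imp_div_less mult.commute)

lemma mod_less_N: "j < N * T \<Longrightarrow> j mod N < N"
  by (cases "N = 0") auto

lemma eligibility_elig: "eligibility (N + T) (N * T) elig"
  using div_less_T mod_less_N by (fastforce simp: eligibility_def elig_def)

lemma size_set_subset: "size_set \<subseteq> size_vectors (N * T)"
  by (auto simp: size_set_def size_vectors_def pred_sizes_def peak_sizes_def split: if_splits)

lemma bounded_size_set: "bounded_sizes (N * T) size_set"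
  unfolding bounded_sizes_def
  by (rule exI[of _ "1 + real T"]) (auto simp: size_set_def pred_sizes_def peak_sizes_def)

section \<open>Upper bounds on both optima\<close>

text \<open>Once \<open>j div N\<close> is fixed, \<open>j\<close> is determined by its remainder,
  which takes at most \<open>N\<close> values.\<close>

lemma card_shared_jobs: "card {j. j < N * T \<and> N + j div N = i} \<le> N"
proof -
  have "card {j. j < N * T \<and> N + j div N = i} \<le> card {..<N}"
  proof (rule card_inj_on_le)
    show "inj_on (\<lambda>j. j mod N) {j. j < N * T \<and> N + j div N = i}"
      by (rule inj_onI) (metis (mono_tags, lifting) add_left_cancel div_mult_mod_eq mem_Collect_eq)
  qed (use mod_less_N in auto)
  then show ?thesis by simp
qed

lemma card_home_jobs: "card {j. j < N * T \<and> j mod N = i} \<le> T"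
proof -
  have "card {j. j < N * T \<and> j mod N = i} \<le> card {..<T}"
  proof (rule card_inj_on_le)
    show "inj_on (\<lambda>j. j div N) {j. j < N * T \<and> j mod N = i}"
      by (rule inj_onI) (metis (mono_tags, lifting) div_mult_mod_eq mem_Collect_eq)
  qed (use div_less_T in auto)
  then show ?thesis by simp
qed

lemma OPT_q_pred_le:
  assumes "0 < T"
  shows "OPT (N + T) (N * T) q_pred \<le> of_nat N"
proof -
  let ?S = "schedule_of (N + T) (N * T) (\<lambda>j. N + j div N)"
  have "Cmax (N + T) ?S q_pred \<le> of_nat N"
  proof (rule Cmax_schedule_of_le)
    fix i
    have "(\<Sum>j | j < N * T \<and> N + j div N = i. q_pred i j)
        = (\<Sum>j | j < N * T \<and> N + j div N = i. 1)"
      by (intro sum.cong) (auto simp: restricted_scenario_def elig_def pred_sizes_def)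
    also have "\<dots> \<le> of_nat N"
      using card_shared_jobs[of i] by simp
    finally show "(\<Sum>j | j < N * T \<and> N + j div N = i. q_pred i j) \<le> of_nat N" .
  qed (use assms in simp)
  moreover have "?S \<in> schedules (N + T) (N * T)"
    using div_less_T by (intro schedule_of_in_schedules) auto
  ultimately show ?thesis
    using OPT_le order_trans by blast
qed

lemma OPT_rob_size_set_le:
  assumes "0 < N"
  shows "OPT_rob (N + T) (N * T) (restricted_scenario elig ` size_set) \<le> of_nat T"
proof (rule OPT_rob_le)
  let ?S = "schedule_of (N + T) (N * T) (\<lambda>j. j mod N)"
  show "?S \<in> schedules (N + T) (N * T)"
    using assms by (intro schedule_of_in_schedules) (auto intro: trans_less_add1)
  \<comment> \<open>The prediction belongs to the uncertainty set as well, so the home schedule has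
    to handle it too.\<close>
  have pred: "Cmax (N + T) ?S q_pred \<le> of_nat T"
  proof (rule Cmax_schedule_of_le)
    fix i
    have "(\<Sum>j | j < N * T \<and> j mod N = i. q_pred i j) = (\<Sum>j | j < N * T \<and> j mod N = i. 1)"
      by (intro sum.cong) (auto simp: restricted_scenario_def elig_def pred_sizes_def)
    also have "\<dots> \<le> of_nat T"
      using card_home_jobs[of i] by simp
    finally show "(\<Sum>j | j < N * T \<and> j mod N = i. q_pred i j) \<le> of_nat T" .
  qed (use assms in simp)
  have peak: "Cmax (N + T) ?S (q_peak t) \<le> of_nat T" for t
  proof (rule Cmax_schedule_of_le)
    fix i
    \<comment> \<open>Among the jobs with home machine \<open>i\<close>, only the one paired with
      shared machine \<open>t\<close> can have nonzero size.\<close>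
    have "(\<Sum>j | j < N * T \<and> j mod N = i. q_peak t i j)
        = (\<Sum>j | j < N * T \<and> j mod N = i. if j = i + N * t then of_nat T else 0)"
      using assms
      by (intro sum.cong)
        (auto simp: restricted_scenario_def elig_def peak_sizes_def ennreal_of_nat_eq_real_of_nat)
    also have "\<dots> \<le> of_nat T"
      by (subst sum.delta) auto
    finally show "(\<Sum>j | j < N * T \<and> j mod N = i. q_peak t i j) \<le> of_nat T" .
  qed (use assms in simp)
  show "Cmax (N + T) ?S q \<le> of_nat T" if "q \<in> restricted_scenario elig ` size_set" for q
    using that pred peak by (auto simp: size_set_def)
qed

section \<open>Trade-off between consistency and robustness\<close>

text \<open>
  An ineligible placement costs \<open>\<infinity>\<close>, so a job on a home machine costs at least 1 under the
  prediction and a job on shared machine \<open>t\<close> costs at least \<open>T\<close> in scenario \<open>t\<close>, eligible or not.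
\<close>

lemma makespan_tradeoff:
  assumes S: "S \<in> schedules (N + T) (N * T)"
  shows "of_nat (N * T * T)
      \<le> of_nat (N * T) * Cmax (N + T) S q_pred + (\<Sum>t<T. Cmax (N + T) S (q_peak t))"
proof -
  have sub: "S i \<subseteq> {..<N * T}" if "i < N + T" for i
    using S that by (auto simp: schedules_def PiE_def Pi_def)
  have home: "of_nat (card (S g)) \<le> Cmax (N + T) S q_pred" if "g < N" for g
  proof -
    have "of_nat (card (S g)) * 1 \<le> (\<Sum>j\<in>S g. q_pred g j)"
      using sub[of g] that
      by (intro card_times_le_sum_ennreal) (auto simp: restricted_scenario_def pred_sizes_def)
    also have "\<dots> \<le> Cmax (N + T) S q_pred"
      using that by (intro load_le_Cmax) auto
    finally show ?thesis by simp
  qed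
  have shared: "of_nat (card (S (N + t))) * of_nat T \<le> Cmax (N + T) S (q_peak t)" if "t < T" for t
  proof -
    have "of_nat (card (S (N + t))) * of_nat T \<le> (\<Sum>j\<in>S (N + t). q_peak t (N + t) j)"
    proof (rule card_times_le_sum_ennreal)
      fix j assume "j \<in> S (N + t)"
      with sub[of "N + t"] that have "j < N * T" by auto
      \<comment> \<open>Machine \<open>N + t\<close> is not the home of \<open>j\<close>, so
        \<open>j\<close> is eligible there only if \<open>j div N = t\<close>, and then its size is
        \<open>T\<close>.\<close>
      moreover from this have "N + t \<noteq> j mod N"
        using mod_less_N[of j] by simp
      ultimately show "of_nat T \<le> q_peak t (N + t) j"
        by (auto simp: restricted_scenario_def elig_def peak_sizes_def
            ennreal_of_nat_eq_real_of_nat)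
    qed
    also have "\<dots> \<le> Cmax (N + T) S (q_peak t)"
      using that by (intro load_le_Cmax) auto
    finally show ?thesis .
  qed
  have "N * T = (\<Sum>g<N. card (S g)) + (\<Sum>t<T. card (S (N + t)))"
    using sum_card_schedule[OF S] by (simp add: sum_lessThan_add)
  \<comment> \<open>The factor \<open>T\<close> turns the job counts on shared machines into the
    loads bounded in \<open>shared\<close>.\<close>
  then have "N * T * T = T * (\<Sum>g<N. card (S g)) + (\<Sum>t<T. card (S (N + t)) * T)"
    by (simp add: distrib_left sum_distrib_left mult.commute)
  then have "(of_nat (N * T * T) :: ennreal)
      = of_nat (T * (\<Sum>g<N. card (S g)) + (\<Sum>t<T. card (S (N + t)) * T))"
    by (rule arg_cong)
  also have "\<dots> = of_nat T * (\<Sum>g<N. of_nat (card (S g)))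
      + (\<Sum>t<T. of_nat (card (S (N + t))) * of_nat T)"
    by simp
  also have "\<dots> \<le> of_nat T * (\<Sum>g<N. Cmax (N + T) S q_pred)
      + (\<Sum>t<T. Cmax (N + T) S (q_peak t))"
    using home shared by (intro add_mono mult_left_mono sum_mono) auto
  \<comment> \<open>All \<open>N\<close> home machines share one bound, which gives the coefficient
    \<open>N * T\<close>.\<close>
  also have "of_nat T * (\<Sum>g<N. Cmax (N + T) S q_pred) = of_nat (N * T) * Cmax (N + T) S q_pred"
    by (simp add: mult_ac)
  finally show ?thesis .
qed

text \<open>The bound for single schedules holds on the whole support of \<open>D\<close> and is
  linear in the makespans, so it passes to expectations.\<close>

lemma expected_makespan_tradeoff:
  assumes "random_schedule (N + T) (N * T) D"
  shows "of_nat (N * T * T)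
      \<le> of_nat (N * T) * expected_Cmax (N + T) D q_pred
        + (\<Sum>t<T. expected_Cmax (N + T) D (q_peak t))"
proof -
  have "of_nat (N * T * T) = (\<integral>\<^sup>+ S. of_nat (N * T * T) \<partial>measure_pmf D)"
    by simp
  also have "\<dots> \<le> (\<integral>\<^sup>+ S. of_nat (N * T) * Cmax (N + T) S q_pred
      + (\<Sum>t<T. Cmax (N + T) S (q_peak t)) \<partial>measure_pmf D)"
    using assms makespan_tradeoff unfolding random_schedule_def
    by (intro nn_integral_mono_AE) (auto simp: AE_measure_pmf_iff)
  also have "\<dots> = of_nat (N * T) * expected_Cmax (N + T) D q_pred
      + (\<Sum>t<T. expected_Cmax (N + T) D (q_peak t))"
    unfolding expected_Cmax_def
    by (simp add: nn_integral_add nn_integral_cmult nn_integral_sum)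
  finally show ?thesis .
qed

text \<open>The optima occur only on the right of the two guarantees, so their upper bounds
  \<open>N\<close> and \<open>T\<close> may replace them. Both sides are then finite, which allows
  the passage from \<open>ennreal\<close> to the reals.\<close>

lemma consistent_robust_bound:
  assumes "0 < N" "0 < T" "0 \<le> \<alpha>" "0 \<le> \<beta>"
    and "random_schedule (N + T) (N * T) D"
    and "consistent (N + T) (N * T) q_pred \<alpha> D"
    and "robust (N + T) (N * T) (restricted_scenario elig ` size_set) \<beta> D"
  shows "real N * real T \<le> \<alpha> * (real N)\<^sup>2 + \<beta> * real T"
proof -
  have c: "expected_Cmax (N + T) D q_pred \<le> ennreal \<alpha> * of_nat N"
    using assms(6) OPT_q_pred_le[OF assms(2)] unfolding consistent_def
    by (meson mult_left_mono order_trans zero_le)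
  have r: "expected_Cmax (N + T) D (q_peak t) \<le> ennreal \<beta> * of_nat T" if "t < T" for t
  proof -
    have "q_peak t \<in> restricted_scenario elig ` size_set"
      using that by (auto simp: size_set_def)
    with assms(7) OPT_rob_size_set_le[OF assms(1)] show ?thesis
      unfolding robust_def by (meson mult_left_mono order_trans zero_le)
  qed
  have "ennreal (real N * real T * real T) = of_nat (N * T * T)"
    by (simp add: ennreal_of_nat_eq_real_of_nat)
  also have "\<dots> \<le> of_nat (N * T) * (ennreal \<alpha> * of_nat N) + (\<Sum>t<T. ennreal \<beta> * of_nat T)"
    using c r
    by (intro order_trans[OF expected_makespan_tradeoff[OF assms(5)]] add_mono mult_left_mono
        sum_mono) auto
  also have "\<dots> = ennreal (real N * real T * (\<alpha> * real N) + real T * (\<beta> * real T))"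
    using assms(3,4) by (simp add: ennreal_of_nat_eq_real_of_nat ennreal_mult)
  finally have "real N * real T * real T
      \<le> real N * real T * (\<alpha> * real N) + real T * (\<beta> * real T)"
    using assms(3,4) by (subst (asm) ennreal_le_iff) auto
  then have "real T * (real N * real T) \<le> real T * (\<alpha> * (real N)\<^sup>2 + \<beta> * real T)"
    by (simp add: algebra_simps power2_eq_square)
  with assms(2) show ?thesis by simp
qed

end

theorem theorem12:
  fixes \<alpha> \<beta> :: real
  assumes "\<alpha> \<ge> 1" and "\<beta> \<ge> 1"
  shows "\<exists>(m::nat) (n::nat) (M :: nat \<Rightarrow> nat set) (P :: (nat \<Rightarrow> real) set)
            (U :: (nat \<Rightarrow> nat \<Rightarrow> ennreal) set) (q_hat :: nat \<Rightarrow> nat \<Rightarrow> ennreal).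
           0 < m \<and> 0 < n \<and> eligibility m n M \<and>
           P \<subseteq> size_vectors n \<and> P \<noteq> {} \<and> bounded_sizes n P \<and>
           U = restricted_scenario M ` P \<and> q_hat \<in> U \<and>
           \<not> (\<exists>D. random_schedule m n D \<and> consistent m n q_hat \<alpha> D \<and> robust m n U \<beta> D)"
proof -
  \<comment> \<open>This choice makes \<open>\<beta> * T\<close> less than half of
    \<open>N * T\<close>; the choice of \<open>T\<close>, which depends on \<open>N\<close>, does
    the same for \<open>\<alpha> * N * N\<close>.\<close>
  obtain N :: nat where N: "2 * \<beta> < real N"
    using reals_Archimedean2 by blast
  obtain T :: nat where T: "2 * \<alpha> * real N < real T"
    using reals_Archimedean2 by blast
  have "0 < real N" using N assms(2) by linarith
  moreover from this have "0 < 2 * \<alpha> * real N" using assms(1) by simp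
  with T have "0 < real T" by linarith
  ultimately have pos: "0 < N" "0 < T" by simp_all
  have "\<alpha> * (real N)\<^sup>2 + \<beta> * real T < real N * real T"
  proof -
    have "2 * \<alpha> * real N * real N < real T * real N"
      using T pos by (intro mult_strict_right_mono) auto
    moreover have "2 * \<beta> * real T < real N * real T"
      using N pos by (intro mult_strict_right_mono) auto
    ultimately show ?thesis
      by (simp add: power2_eq_square algebra_simps)
  qed
  then have "\<not> (\<exists>D. random_schedule (N + T) (N * T) D
      \<and> consistent (N + T) (N * T) (restricted_scenario (elig N) (pred_sizes N T)) \<alpha> D
      \<and> robust (N + T) (N * T) (restricted_scenario (elig N) ` size_set N T) \<beta> D)"
    using consistent_robust_bound[OF pos, of \<alpha> \<beta>] assms by fastforce
  moreover have "pred_sizes N T \<in> size_set N T"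
    by (simp add: size_set_def)
  ultimately show ?thesis
    using pos eligibility_elig[of N T] size_set_subset[of N T] bounded_size_set[of N T]
    by (intro exI[of _ "N + T"] exI[of _ "N * T"] exI[of _ "elig N"] exI[of _ "size_set N T"]
        exI[of _ "restricted_scenario (elig N) ` size_set N T"]
        exI[of _ "restricted_scenario (elig N) (pred_sizes N T)"]) auto
qed

end
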